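(* Let $\Gamma\le\mathcal{S}_n$ have a (nonzero) irrational invariant subspace. If $k\in\mathbb{Z}$ is not a multiple of $n$, then $\Gamma$ has infinitely many core points in the layer $\mathbb{Z}^n_{(k)}$.
   Context: $\mathcal{S}_n$ is the symmetric group on $[n]=\{1,\dots,n\}$; a subgroup $\Gamma\le\mathcal{S}_n$ acts on $\mathbb{R}^n$ by permuting coordinates. A linear subspace $V\subseteq\mathbb{R}^n$ is $\Gamma$-invariant if $\Gamma V=V$ (setwise). A $\Gamma$-invariant subspace $V$ is called irrational if it contains no rational vector other than zero, i.e. $V\cap\mathbb{Q}^n=\{0\}$. A point $z\in\mathbb{Z}^n$ is a core point with respect to $\Gamma$ if $\operatorname{conv}(\Gamma z)\cap\mathbb{Z}^n=\Gamma z$. The layer with index $k$ is $\mathbb{Z}^n_{(k)}=\{x\in\mathbb{Z}^n : \sum_{i=1}^n x_i=k\}$. *)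

theory Defs
  imports "HOL-Analysis.Analysis" "HOL-Algebra.Bij"
begin

text \<open>
  The index set \<open>[n]\<close> is the universe of a finite type \<open>'n\<close>, so \<open>n = CARD('n)\<close>, \<open>\<real>\<^sup>n\<close> is
  \<open>real ^ 'n\<close>, and the symmetric group on \<open>[n]\<close> is \<open>BijGroup (UNIV :: 'n set)\<close>.
\<close>

text \<open>
  The inverse makes this a left action: the entry at position \<open>i\<close> moves to position \<open>g i\<close>, that
  is, \<open>g\<close> maps the \<open>i\<close>-th unit vector to the \<open>g i\<close>-th one.
\<close>
definition perm_act :: "('n \<Rightarrow> 'n) \<Rightarrow> real ^ 'n \<Rightarrow> real ^ 'n::finite" where
  "perm_act g x = (\<chi> i. x $ (inv_into UNIV g i))"

definition orbit_pt :: "('n \<Rightarrow> 'n) set \<Rightarrow> real ^ 'n \<Rightarrow> (real ^ 'n::finite) set" where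
  "orbit_pt \<Gamma> x = (\<lambda>g. perm_act g x) ` \<Gamma>"

definition invariant_subspace :: "('n \<Rightarrow> 'n) set \<Rightarrow> (real ^ 'n::finite) set \<Rightarrow> bool" where
  "invariant_subspace \<Gamma> V \<longleftrightarrow> subspace V \<and> (\<Union>g\<in>\<Gamma>. perm_act g ` V) = V"

definition rat_vecs :: "(real ^ 'n::finite) set" where
  "rat_vecs = {x. \<forall>i. x $ i \<in> \<rat>}"

definition int_vecs :: "(real ^ 'n::finite) set" where
  "int_vecs = {x. \<forall>i. x $ i \<in> \<int>}"

text \<open>The zero subspace satisfies this condition; nonzeroness has to be required separately.\<close>
definition irrational_invariant_subspace ::
    "('n \<Rightarrow> 'n) set \<Rightarrow> (real ^ 'n::finite) set \<Rightarrow> bool" where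
  "irrational_invariant_subspace \<Gamma> V \<longleftrightarrow> invariant_subspace \<Gamma> V \<and> V \<inter> rat_vecs = {0}"

definition core_point :: "('n \<Rightarrow> 'n) set \<Rightarrow> real ^ 'n::finite \<Rightarrow> bool" where
  "core_point \<Gamma> z \<longleftrightarrow>
     z \<in> int_vecs \<and> convex hull (orbit_pt \<Gamma> z) \<inter> int_vecs = orbit_pt \<Gamma> z"

definition layer :: "int \<Rightarrow> (real ^ 'n::finite) set" where
  "layer k = {x \<in> int_vecs. (\<Sum>i\<in>UNIV. x $ i) = of_int k}"

end

theory Submission
  imports Defs
begin

text \<open>
  Every set of integer points cut out by a convex \<open>\<Gamma>\<close>-invariant set contains a core point, namely
  a shortest one: a point of the convex hull of its orbit is never longer, and strictly shorter
  outside the orbit. If the irrational subspace \<open>V\<close> is not orthogonal to the all-ones vector, the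
  projection of that vector to \<open>V\<close> is a nonconstant vector fixed by \<open>\<Gamma>\<close>, and the slices of the
  layer on which the inner product with it is constant yield infinitely many core points.
  Otherwise, the principle applied to tubes around \<open>V\<close> shows that if there were only finitely many
  core points, some \<open>z\<close> in the layer would have minimal distance to \<open>V\<close>. A Kronecker-type density
  argument then forces the projection of \<open>z\<close> to \<open>V\<close> to be rational, hence zero. So \<open>z\<close> is
  orthogonal to \<open>V\<close>, and so is every coordinate permutation of \<open>z\<close>. Since \<open>n\<close> does not divide
  \<open>k\<close>, the vector \<open>z\<close> is nonconstant, so all vectors in \<open>V\<close> are constant, which is absurd.
\<close>

section \<open>Coordinate permutations\<close>

lemma inner_perm_act:
  assumes "bij g"
  shows "inner (perm_act g x) (perm_act g y) = inner x y"
proof -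
  have "bij (inv_into UNIV g)"
    using assms by (rule bij_imp_bij_inv)
  then show ?thesis
    unfolding inner_vec_def perm_act_def
    by (simp add: sum.reindex_bij_betw[where g = "\<lambda>i. x $ i * y $ i"])
qed

lemma linear_perm_act: "linear (perm_act g)"
  by (rule linearI) (simp_all add: perm_act_def vec_eq_iff)

lemma norm_perm_act: "bij g \<Longrightarrow> norm (perm_act g x) = norm x"
  by (simp add: norm_eq_sqrt_inner inner_perm_act)

lemma dist_perm_act: "bij g \<Longrightarrow> dist (perm_act g x) (perm_act g y) = dist x y"
  by (simp add: dist_norm norm_perm_act flip: linear_diff[OF linear_perm_act])

lemma perm_act_one: "perm_act g 1 = 1"
  by (simp add: perm_act_def vec_eq_iff)

lemma perm_act_int_vecs: "x \<in> int_vecs \<Longrightarrow> perm_act g x \<in> int_vecs"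
  by (simp add: perm_act_def int_vecs_def)

lemma inner_one_perm_act: "bij g \<Longrightarrow> inner (perm_act g x) 1 = inner x 1"
  using inner_perm_act[of g x 1] by (simp add: perm_act_one)

lemma subgroup_BijGroup_bij: "subgroup \<Gamma> (BijGroup UNIV) \<Longrightarrow> g \<in> \<Gamma> \<Longrightarrow> bij g"
  using subgroup.subset[of \<Gamma> "BijGroup UNIV"] by (auto simp: BijGroup_def Bij_def)

lemma invariant_subspace_perm_act:
  "invariant_subspace \<Gamma> V \<Longrightarrow> g \<in> \<Gamma> \<Longrightarrow> v \<in> V \<Longrightarrow> perm_act g v \<in> V"
  unfolding invariant_subspace_def by blast

section \<open>Integer vectors\<close>

lemma int_vecs_0: "0 \<in> int_vecs"
  by (simp add: int_vecs_def)

lemma int_vecs_add: "x \<in> int_vecs \<Longrightarrow> y \<in> int_vecs \<Longrightarrow> x + y \<in> int_vecs"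
  by (simp add: int_vecs_def)

lemma int_vecs_diff: "x \<in> int_vecs \<Longrightarrow> y \<in> int_vecs \<Longrightarrow> x - y \<in> int_vecs"
  by (simp add: int_vecs_def)

lemma int_vecs_axis: "c \<in> \<int> \<Longrightarrow> axis i c \<in> int_vecs"
  by (simp add: int_vecs_def axis_def)

lemma int_vecs_subset_rat_vecs: "int_vecs \<subseteq> rat_vecs"
  using Ints_subset_Rats by (auto simp: int_vecs_def rat_vecs_def)

lemma inner_axis_one: "inner (axis i c) (1 :: real ^ 'n::finite) = c"
  by (simp add: inner_axis')

lemma layer_eq: "layer k = {x \<in> int_vecs. inner x 1 = of_int k}"
  by (simp add: layer_def inner_vec_def)

section \<open>Shortest integer points and core points\<close>

lemma int_vecs_min_norm:
  fixes A :: "(real ^ 'n::finite) set"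
  assumes "A \<subseteq> int_vecs" and "A \<noteq> {}"
  obtains z where "z \<in> A" and "\<And>y. y \<in> A \<Longrightarrow> norm z \<le> norm y"
proof -
  \<comment> \<open>Squared norms of integer vectors are nonnegative integers, so passing to
    \<open>nat\<close> of the floor loses nothing and the well-ordering of the naturals
    applies.\<close>
  obtain z where z: "z \<in> A"
    and min: "\<And>y. y \<in> A \<Longrightarrow> nat \<lfloor>inner z z\<rfloor> \<le> nat \<lfloor>inner y y\<rfloor>"
    using ex_has_least_nat[of "\<lambda>x. x \<in> A" _ "\<lambda>x. nat \<lfloor>inner x x\<rfloor>"] assms(2) by blast
  have Ints: "inner y y \<in> \<int>" if "y \<in> A" for y
    using that assms(1) by (auto simp: inner_vec_def int_vecs_def intro!: Ints_sum Ints_mult)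
  have "norm z \<le> norm y" if "y \<in> A" for y
  proof -
    have "\<lfloor>inner z z\<rfloor> \<le> \<lfloor>inner y y\<rfloor>"
      using min[OF that] by (simp add: nat_le_eq_zle)
    then have "inner z z \<le> inner y y"
      using Ints[OF z] Ints[OF that] by (metis of_int_floor of_int_le_iff)
    then show ?thesis
      by (simp add: norm_eq_sqrt_inner)
  qed
  with z that show thesis
    by blast
qed

text \<open>Strict convexity of the ball: any other point of the same norm lies in the open
  halfspace bounded by the tangent hyperplane at \<open>x\<close>, and so would the whole
  hull.\<close>

lemma convex_hull_sphere_extreme:
  fixes S :: "'a::real_inner set"
  assumes "x \<in> convex hull S" and "\<And>s. s \<in> S \<Longrightarrow> norm s = norm x"
  shows "x \<in> S"
proof (rule ccontr)
  assume "x \<notin> S"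
  have "inner x s < inner x x" if "s \<in> S" for s
  proof -
    have "0 < inner (x - s) (x - s)"
      using that \<open>x \<notin> S\<close> by auto
    moreover have "inner s s = inner x x"
      using assms(2)[OF that] by (simp add: norm_eq_sqrt_inner)
    ultimately show ?thesis
      by (simp add: inner_diff_left inner_diff_right inner_commute)
  qed
  then have "S \<subseteq> {y. inner x y < inner x x}"
    by blast
  then have "convex hull S \<subseteq> {y. inner x y < inner x x}"
    by (intro hull_minimal convex_halfspace_lt)
  with assms(1) show False
    by blast
qed

text \<open>For a shortest integer point \<open>z\<close> of \<open>C\<close>, the hull of its orbit
  lies both in \<open>C\<close> and in the ball of radius \<open>norm z\<close>. By minimality its
  integer points lie on the sphere, hence in the orbit.\<close>

lemma core_point_in_convex_invariant_set:
  fixes \<Gamma> :: "('n::finite \<Rightarrow> 'n) set"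
  assumes "subgroup \<Gamma> (BijGroup UNIV)" and "convex C"
    and inv: "\<And>g x. g \<in> \<Gamma> \<Longrightarrow> x \<in> C \<Longrightarrow> perm_act g x \<in> C"
    and "int_vecs \<inter> C \<noteq> {}"
  obtains z where "z \<in> int_vecs" and "z \<in> C" and "core_point \<Gamma> z"
proof -
  obtain z where z: "z \<in> int_vecs \<inter> C"
    and min: "\<And>y. y \<in> int_vecs \<inter> C \<Longrightarrow> norm z \<le> norm y"
    by (rule int_vecs_min_norm[OF Int_lower1 assms(4)]) iprover
  let ?O = "orbit_pt \<Gamma> z"
  have norm_orbit: "norm y = norm z" if "y \<in> ?O" for y
    using that subgroup_BijGroup_bij[OF assms(1)] by (auto simp: orbit_pt_def norm_perm_act)
  have "convex hull ?O \<subseteq> C"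
    using assms(2) inv z by (intro hull_minimal) (auto simp: orbit_pt_def)
  moreover have "convex hull ?O \<subseteq> cball 0 (norm z)"
    using norm_orbit by (intro hull_minimal convex_cball) auto
  ultimately have "y \<in> ?O" if y: "y \<in> convex hull ?O" "y \<in> int_vecs" for y
  proof (intro convex_hull_sphere_extreme[OF y(1)])
    have "norm y = norm z"
      using y \<open>_ \<subseteq> C\<close> \<open>_ \<subseteq> cball _ _\<close> by (intro antisym min) auto
    then show "norm s = norm y" if "s \<in> ?O" for s
      using norm_orbit[OF that] by simp
  qed
  moreover have "?O \<subseteq> convex hull ?O \<inter> int_vecs"
    using z hull_subset[of ?O convex] by (auto simp: orbit_pt_def perm_act_int_vecs)
  ultimately have "core_point \<Gamma> z"
    using z by (auto simp: core_point_def)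
  with z show thesis
    by (intro that) auto
qed

section \<open>A nonconstant fixed vector\<close>

lemma infinite_core_points_if_fixed_vector:
  fixes \<Gamma> :: "('n::finite \<Rightarrow> 'n) set"
  assumes \<Gamma>: "subgroup \<Gamma> (BijGroup UNIV)"
    and fixed: "\<And>g. g \<in> \<Gamma> \<Longrightarrow> perm_act g p = p" and ne: "p $ i \<noteq> p $ j"
  shows "infinite {z \<in> layer k. core_point \<Gamma> z}"
proof -
  \<comment> \<open>\<open>c m\<close> is the inner product with \<open>p\<close> of the layer point
    having \<open>m\<close> at position \<open>i\<close>, \<open>k - m\<close> at position
    \<open>j\<close> and zeros elsewhere. It is injective in \<open>m\<close> because
    \<open>p $ i\<close> and \<open>p $ j\<close> differ.\<close>
  define c where "c m = of_int m * (p $ i - p $ j) + of_int k * p $ j" for m :: int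
  have "\<exists>z \<in> layer k. core_point \<Gamma> z \<and> inner z p = c m" for m
  proof -
    define C where "C = {x. inner 1 x = of_int k} \<inter> {x. inner p x = c m}"
    have "convex C"
      unfolding C_def by (intro convex_Int convex_hyperplane)
    moreover have "perm_act g x \<in> C" if "g \<in> \<Gamma>" "x \<in> C" for g x
    proof -
      have "bij g"
        using \<Gamma> that(1) by (rule subgroup_BijGroup_bij)
      then show ?thesis
        using that inner_perm_act[of g p x] inner_perm_act[of g 1 x] fixed[OF that(1)]
        by (simp add: C_def perm_act_one)
    qed
    moreover have "axis i (of_int m) + axis j (of_int (k - m)) \<in> int_vecs \<inter> C"
      using ne by (auto simp: C_def c_def int_vecs_add int_vecs_axis inner_add_right
          inner_commute[of _ "axis _ _"] inner_axis_one inner_axis' algebra_simps)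
    ultimately obtain z where "z \<in> int_vecs" "z \<in> C" "core_point \<Gamma> z"
      using core_point_in_convex_invariant_set[OF \<Gamma>, of C] by blast
    then show ?thesis
      by (auto simp: C_def layer_eq inner_commute)
  qed
  then have "range c \<subseteq> (\<lambda>z. inner z p) ` {z \<in> layer k. core_point \<Gamma> z}"
    by (metis (mono_tags, lifting) image_eqI image_subsetI mem_Collect_eq)
  moreover have "inj c"
    using ne by (auto simp: c_def inj_def)
  then have "infinite (range c)"
    using finite_imageD infinite_UNIV_char_0 by blast
  ultimately show ?thesis
    using finite_surj by blast
qed

section \<open>Orthogonal projection to rational subspaces\<close>

text \<open>Gram-Schmidt orthogonalisation, which divides only by inner products of rational vectors
  and thus stays rational.\<close>

lemma rat_vecs_proj:
  fixes B :: "(real ^ 'n::finite) set"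
  assumes "finite B" and "B \<subseteq> rat_vecs" and "z \<in> rat_vecs"
  shows "\<exists>w. w \<in> span B \<and> w \<in> rat_vecs \<and> (\<forall>b\<in>B. inner (z - w) b = 0)"
  using assms
proof (induction B arbitrary: z rule: finite_induct)
  case empty
  show ?case
    by (intro exI[of _ 0]) (simp add: span_0 rat_vecs_def)
next
  case (insert b B)
  obtain w where w: "w \<in> span B" "w \<in> rat_vecs" "\<And>x. x \<in> B \<Longrightarrow> inner (z - w) x = 0"
    using insert.IH[of z] insert.prems by auto
  obtain u where u: "u \<in> span B" "u \<in> rat_vecs" "\<And>x. x \<in> B \<Longrightarrow> inner (b - u) x = 0"
    using insert.IH[of b] insert.prems by auto
  \<comment> \<open>\<open>d\<close> is the part of \<open>b\<close> orthogonal to \<open>B\<close>.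
    If \<open>b\<close> lies in the span of \<open>B\<close>, then \<open>d = 0\<close>, and
    division by zero yields \<open>t = 0\<close>, which is still correct.\<close>
  define d where "d = b - u"
  define t where "t = inner (z - w) d / inner d d"
  have rat: "d \<in> rat_vecs" "z - w \<in> rat_vecs"
    using u(2) w(2) insert.prems by (auto simp: d_def rat_vecs_def)
  then have "t \<in> \<rat>"
    by (auto simp: t_def inner_vec_def rat_vecs_def intro!: Rats_divide Rats_sum Rats_mult)
  have "w + t *\<^sub>R d \<in> span (insert b B)"
    using w(1) u(1) span_mono[of B "insert b B"] unfolding d_def
    by (intro span_add span_scale span_diff) (auto intro: span_base)
  moreover have "w + t *\<^sub>R d \<in> rat_vecs"
    using w(2) rat(1) \<open>t \<in> \<rat>\<close> by (simp add: rat_vecs_def)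
  moreover have orth: "inner (z - (w + t *\<^sub>R d)) x = 0" if "x \<in> B" for x
    using w(3)[OF that] u(3)[OF that] by (simp add: d_def algebra_simps)
  moreover have "inner (z - (w + t *\<^sub>R d)) b = 0"
  proof -
    have "inner (z - (w + t *\<^sub>R d)) d = 0"
      by (simp add: t_def inner_diff_left inner_add_left)
    moreover have "inner (z - (w + t *\<^sub>R d)) u = 0"
      using orthogonal_to_span[of u B "z - (w + t *\<^sub>R d)"] u(1) orth
      by (simp add: orthogonal_def)
    ultimately show ?thesis
      by (simp add: d_def inner_diff_right)
  qed
  ultimately show ?case
    by (intro exI[of _ "w + t *\<^sub>R d"]) auto
qed

text \<open>Orthogonal projections are unique, so \<open>w\<close> agrees with the rational one
  computed from a finite basis chosen inside \<open>X\<close>.\<close>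

lemma rat_vecs_orthogonal_proj:
  fixes X :: "(real ^ 'n::finite) set"
  assumes "X \<subseteq> rat_vecs" and "z \<in> rat_vecs"
    and "w \<in> span X" and orth: "\<And>x. x \<in> X \<Longrightarrow> inner (z - w) x = 0"
  shows "w \<in> rat_vecs"
proof -
  obtain B where B: "B \<subseteq> X" "independent B" "X \<subseteq> span B"
    by (rule basis_exists)
  then obtain w' where w': "w' \<in> span B" "w' \<in> rat_vecs" "\<And>b. b \<in> B \<Longrightarrow> inner (z - w') b = 0"
    using rat_vecs_proj[of B z] assms(1,2) independent_imp_finite by blast
  have "span X = span B"
    using B by (metis span_eq span_superset subset_trans)
  then have "w - w' \<in> span B"
    using assms(3) w'(1) by (simp add: span_diff)
  moreover have "inner (w - w') b = 0" if "b \<in> B" for b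
    using orth[of b] w'(3)[OF that] that B(1) by (auto simp: inner_diff_left)
  ultimately have "inner (w - w') (w - w') = 0"
    using orthogonal_to_span[of "w - w'" B "w - w'"] by (simp add: orthogonal_def)
  with w'(2) show ?thesis
    by simp
qed

section \<open>Lines in a closed subgroup\<close>

text \<open>For an additive subgroup \<open>G\<close> this is the largest linear subspace contained
  in \<open>G\<close>.\<close>

definition lines :: "'a::real_vector set \<Rightarrow> 'a set" where
  "lines G = {u. \<forall>t. t *\<^sub>R u \<in> G}"

lemma subspace_lines:
  assumes "\<And>x y. x \<in> G \<Longrightarrow> y \<in> G \<Longrightarrow> x + y \<in> G" and "0 \<in> G"
  shows "subspace (lines G)"
  using assms by (auto simp: subspace_def lines_def scaleR_add_right)

lemma scaleR_of_int_mem: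
  fixes G :: "'a::real_vector set"
  assumes diff: "\<And>x y. x \<in> G \<Longrightarrow> y \<in> G \<Longrightarrow> x - y \<in> G" and "h \<in> G"
  shows "of_int m *\<^sub>R h \<in> G"
proof (induction m rule: int_induct[where k = 0])
  case base
  show ?case
    using diff[OF assms(2,2)] by auto
next
  case (step1 i)
  have "0 - h \<in> G"
    using diff[OF diff[OF assms(2,2)] assms(2)] by simp
  then show ?case
    using diff[OF step1(2)] by (force simp: scaleR_add_left)
next
  case (step2 i)
  then show ?case
    using diff[OF step2(2) assms(2)] by (simp add: scaleR_diff_left)
qed

text \<open>Otherwise there are arbitrarily short nonzero elements of \<open>G\<close> orthogonal to
  \<open>lines G\<close>. Their directions accumulate at a unit vector \<open>e\<close>, and their
  integer multiples approximate every real multiple of \<open>e\<close>. Closedness puts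
  \<open>e\<close> into \<open>lines G\<close>, to which it is orthogonal.\<close>

lemma closed_subgroup_near_0_subset_lines:
  fixes G :: "'a::euclidean_space set"
  assumes "closed G" and zero: "0 \<in> G" and diff: "\<And>x y. x \<in> G \<Longrightarrow> y \<in> G \<Longrightarrow> x - y \<in> G"
  shows "\<exists>\<delta>>0. \<forall>g\<in>G. norm g < \<delta> \<longrightarrow> g \<in> lines G"
proof (rule ccontr)
  assume "\<not> ?thesis"
  then have "\<exists>g \<in> G. norm g < \<delta> \<and> g \<notin> lines G" if "\<delta> > 0" for \<delta>
    using that by blast
  then have "\<exists>g \<in> G. norm g < 1 / real (Suc m) \<and> g \<notin> lines G" for m
    by simp
  then obtain g where g: "\<And>m. g m \<in> G" "\<And>m. norm (g m) < 1 / real (Suc m)" "\<And>m. g m \<notin> lines G"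
    by metis
  have add: "x + y \<in> G" if "x \<in> G" "y \<in> G" for x y
    using diff[OF that(1) diff[OF zero that(2)]] by simp
  have sub: "subspace (lines G)"
    using add zero by (rule subspace_lines)
  \<comment> \<open>The component of \<open>g m\<close> in \<open>lines G\<close> belongs to
    \<open>G\<close>; subtracting it leaves an element of \<open>G\<close> that is no longer than
    \<open>g m\<close>.\<close>
  have "\<exists>h \<in> G. norm h < 1 / real (Suc m) \<and> h \<noteq> 0 \<and> (\<forall>u \<in> lines G. inner h u = 0)" for m
  proof -
    obtain u h where uh: "u \<in> span (lines G)" "\<And>w. w \<in> span (lines G) \<Longrightarrow> orthogonal h w"
      "g m = u + h"
      using orthogonal_subspace_decomp_exists[of "lines G" "g m"] by blast
    have u: "u \<in> lines G"
      using uh(1) sub span_eq_iff by blast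
    then have "u \<in> G"
      using scaleR_one[of u] unfolding lines_def by (metis mem_Collect_eq)
    then have "h \<in> G"
      using diff[OF g(1)[of m], of u] uh(3) by simp
    moreover have "h \<noteq> 0"
      using g(3)[of m] u uh(3) by auto
    moreover have orth: "inner h w = 0" if "w \<in> lines G" for w
      using uh(2)[OF span_base[OF that]] by (simp add: orthogonal_def)
    moreover have "norm h \<le> norm (g m)"
      using orth[OF u] by (simp add: uh(3) norm_le inner_add_left inner_add_right inner_commute)
    ultimately show ?thesis
      using g(2)[of m] by (intro bexI[of _ h]) auto
  qed
  then obtain h where h: "\<And>m. h m \<in> G" "\<And>m. norm (h m) < 1 / real (Suc m)" "\<And>m. h m \<noteq> 0"
    "\<And>m u. u \<in> lines G \<Longrightarrow> inner (h m) u = 0"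
    by metis
  define d where "d m = h m /\<^sub>R norm (h m)" for m
  have "\<And>m. d m \<in> sphere 0 1"
    using h(3) by (simp add: d_def)
  then obtain e r where e: "e \<in> sphere 0 1" and r: "strict_mono r" and lim: "(d \<circ> r) \<longlonglongrightarrow> e"
    using compact_sphere[of "0::'a" 1] unfolding compact_def by blast
  have h0: "(\<lambda>m. norm (h (r m))) \<longlonglongrightarrow> 0"
  proof -
    have "h \<longlonglongrightarrow> 0"
      using h(2) by (intro LIMSEQ_norm_0) auto
    then show ?thesis
      using LIMSEQ_subseq_LIMSEQ[OF _ r] by (auto simp: o_def dest: tendsto_norm_zero)
  qed
  have "t *\<^sub>R e \<in> G" for t
  proof -
    \<comment> \<open>\<open>t\<close> is rounded down to a multiple of the length of
      \<open>h (r m)\<close>; the error is at most that length and so vanishes in the limit.\<close>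
    define q where "q m = of_int \<lfloor>t / norm (h (r m))\<rfloor> * norm (h (r m))" for m
    have "(\<lambda>m. q m - t) \<longlonglongrightarrow> 0"
    proof (rule Lim_null_comparison[OF _ h0], intro always_eventually allI)
      fix m
      define s where "s = norm (h (r m))"
      have "s > 0"
        using h(3) by (simp add: s_def)
      then have "\<bar>(of_int \<lfloor>t / s\<rfloor> - t / s) * s\<bar> \<le> 1 * s"
        unfolding abs_mult by (intro mult_mono) linarith+
      then show "norm (q m - t) \<le> norm (h (r m))"
        using \<open>s > 0\<close> unfolding q_def s_def[symmetric] by (simp add: left_diff_distrib)
    qed
    then have "q \<longlonglongrightarrow> t"
      by (simp add: LIM_zero_iff)
    then have "(\<lambda>m. q m *\<^sub>R (d \<circ> r) m) \<longlonglongrightarrow> t *\<^sub>R e"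
      using lim by (rule tendsto_scaleR)
    moreover have "q m *\<^sub>R (d \<circ> r) m \<in> G" for m
    proof -
      have "q m *\<^sub>R (d \<circ> r) m = of_int \<lfloor>t / norm (h (r m))\<rfloor> *\<^sub>R h (r m)"
        using h(3)[of "r m"] by (simp add: q_def d_def)
      then show ?thesis
        using scaleR_of_int_mem[of G, OF diff h(1)] by simp
    qed
    ultimately show ?thesis
      by (rule closed_sequentially[OF assms(1), rotated])
  qed
  then have "e \<in> lines G"
    by (simp add: lines_def)
  then have "inner ((d \<circ> r) m) e = 0" for m
    using h(4) by (simp add: d_def)
  moreover have "(\<lambda>m. inner ((d \<circ> r) m) e) \<longlonglongrightarrow> inner e e"
    using lim by (intro tendsto_inner tendsto_const)
  ultimately have "(\<lambda>_. 0) \<longlonglongrightarrow> inner e e"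
    by (simp only:)
  then have "inner e e = 0"
    using LIMSEQ_unique tendsto_const by blast
  with e show False
    by simp
qed

section \<open>Lattice points close to an irrational subspace\<close>

text \<open>Rounding down moves each coordinate by at most 1. As \<open>v\<close> has coordinate sum
  0, the sum after rounding has absolute value at most \<open>CARD('n)\<close> and can be removed at
  a single coordinate.\<close>

lemma sum_zero_int_vecs_near:
  fixes v :: "real ^ 'n::finite"
  assumes "inner v 1 = 0"
  obtains x where "x \<in> layer 0" and "norm (x - v) \<le> 2 * real CARD('n)"
proof -
  define y :: "real ^ 'n" where "y = (\<chi> i. of_int \<lfloor>v $ i\<rfloor>)"
  fix i :: 'n
  define x where "x = y - axis i (inner y 1)"
  have le1: "\<bar>y $ j - v $ j\<bar> \<le> 1" for j
    by (simp add: y_def) linarith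
  have y: "y \<in> int_vecs"
    by (simp add: y_def int_vecs_def)
  moreover have "inner y 1 \<in> \<int>"
    using y by (auto simp: inner_vec_def int_vecs_def intro!: Ints_sum)
  ultimately have "x \<in> layer 0"
    by (simp add: x_def layer_eq int_vecs_diff int_vecs_axis inner_diff_left inner_axis_one)
  moreover have "norm (x - v) \<le> 2 * real CARD('n)"
  proof -
    have l1: "(\<Sum>j\<in>UNIV. \<bar>(y - v) $ j\<bar>) \<le> real CARD('n)"
      using sum_bounded_above[of UNIV "\<lambda>j. \<bar>(y - v) $ j\<bar>" 1] le1 by simp
    have "inner y 1 = inner (y - v) 1"
      using assms by (simp add: inner_diff_left)
    also have "\<bar>\<dots>\<bar> \<le> (\<Sum>j\<in>UNIV. \<bar>(y - v) $ j\<bar>)"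
      by (simp add: inner_vec_def sum_abs)
    finally have "norm (axis i (inner y 1) :: real ^ 'n) \<le> real CARD('n)"
      using l1 by (simp add: norm_eq_sqrt_inner inner_axis_axis)
    moreover have "norm (y - v) \<le> real CARD('n)"
      using norm_le_l1_cart[of "y - v"] l1 by simp
    ultimately show ?thesis
      using norm_triangle_ineq4[of "y - v" "axis i (inner y 1)"]
      by (simp add: x_def algebra_simps)
  qed
  ultimately show thesis
    by (rule that)
qed

text \<open>The closure makes this a closed subgroup for every subspace \<open>V\<close>, so that
  its short elements lie on lines.\<close>

definition layer_0_plus :: "(real ^ 'n::finite) set \<Rightarrow> (real ^ 'n) set" where
  "layer_0_plus V = closure {x + v | x v. x \<in> layer 0 \<and> v \<in> V}"

lemma layer_0_diff: "x \<in> layer 0 \<Longrightarrow> y \<in> layer 0 \<Longrightarrow> x - y \<in> layer 0"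
  by (simp add: layer_eq int_vecs_diff inner_diff_left)

lemma layer_0_plus_base: "x \<in> layer 0 \<Longrightarrow> v \<in> V \<Longrightarrow> x + v \<in> layer_0_plus V"
  unfolding layer_0_plus_def by (rule subsetD[OF closure_subset]) blast

lemma layer_0_plus_diff:
  assumes "subspace V" and "x \<in> layer_0_plus V" and "y \<in> layer_0_plus V"
  shows "x - y \<in> layer_0_plus V"
proof -
  let ?S = "{x + v | x v. x \<in> layer 0 \<and> v \<in> V}"
  obtain a b where a: "\<And>m. a m \<in> ?S" "a \<longlonglongrightarrow> x" and b: "\<And>m. b m \<in> ?S" "b \<longlonglongrightarrow> y"
    using assms(2,3) unfolding layer_0_plus_def closure_sequential by blast
  have "a m - b m \<in> ?S" for m
  proof -
    obtain p v q w where *: "a m = p + v" "b m = q + w" "p \<in> layer 0" "q \<in> layer 0" "v \<in> V" "w \<in> V"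
      using a(1)[of m] b(1)[of m] by blast
    then have "a m - b m = (p - q) + (v - w)"
      by simp
    with * assms(1) show ?thesis
      using layer_0_diff subspace_diff by blast
  qed
  moreover have "(\<lambda>m. a m - b m) \<longlonglongrightarrow> x - y"
    using a(2) b(2) by (rule tendsto_diff)
  ultimately show ?thesis
    unfolding layer_0_plus_def closure_sequential by (intro exI[of _ "\<lambda>m. a m - b m"]) blast
qed

text \<open>The span on the right is a rational subspace, being spanned by integer vectors. To reach
  \<open>v\<close>, the multiples \<open>m v\<close> are followed by integer points at bounded
  distance. Along a subsequence the errors converge, so differences of these points are nearly in
  \<open>V\<close> and hence in \<open>lines ?G\<close>; rescaled, they tend to
  \<open>v\<close>.\<close>

lemma subspace_subset_span_layer_0:
  fixes V :: "(real ^ 'n::finite) set"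
  assumes V: "subspace V" and V1: "\<And>v. v \<in> V \<Longrightarrow> inner v 1 = 0"
  shows "V \<subseteq> span (layer 0 \<inter> lines (layer_0_plus V))"
proof
  fix v
  assume v: "v \<in> V"
  let ?G = "layer_0_plus V"
  have "0 \<in> ?G"
    using layer_0_plus_base[of 0 0 V] subspace_0[OF V] by (simp add: layer_eq int_vecs_0)
  moreover have "closed ?G"
    by (simp add: layer_0_plus_def)
  ultimately obtain \<delta> where "\<delta> > 0"
    and near0: "\<And>g. g \<in> ?G \<Longrightarrow> norm g < \<delta> \<Longrightarrow> g \<in> lines ?G"
    using closed_subgroup_near_0_subset_lines[of ?G] layer_0_plus_diff[OF V] by blast
  have "(0 :: real ^ 'n) \<in> layer 0"
    by (simp add: layer_eq int_vecs_0)
  then have V_lines: "w \<in> lines ?G" if "w \<in> V" for w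
    using layer_0_plus_base[of 0 "_ *\<^sub>R w" V] that subspace_scale[OF V] by (simp add: lines_def)
  have sub: "subspace (lines ?G)"
  proof (rule subspace_lines)
    show "x + y \<in> ?G" if "x \<in> ?G" "y \<in> ?G" for x y
      using layer_0_plus_diff[OF V that(1) layer_0_plus_diff[OF V \<open>0 \<in> ?G\<close> that(2)]] by simp
  qed fact
  have "\<exists>x \<in> layer 0. norm (x - real m *\<^sub>R v) \<le> 2 * real CARD('n)" for m
    using sum_zero_int_vecs_near[of "real m *\<^sub>R v"] V1[OF v] by auto
  then obtain x where x: "\<And>m. x m \<in> layer 0"
    and bound: "\<And>m. norm (x m - real m *\<^sub>R v) \<le> 2 * real CARD('n)"
    by metis
  define y where "y m = x m - real m *\<^sub>R v" for m
  have "bounded (range y)"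
    using bound by (auto simp: bounded_iff y_def)
  then obtain l r where r: "strict_mono r" and "(y \<circ> r) \<longlonglongrightarrow> l"
    using bounded_imp_convergent_subsequence by blast
  then have "Cauchy (y \<circ> r)"
    by (intro LIMSEQ_imp_Cauchy)
  then obtain M where M: "\<And>m. m \<ge> M \<Longrightarrow> norm (y (r m) - y (r M)) < \<delta>"
    using \<open>\<delta> > 0\<close> unfolding Cauchy_iff o_def by blast
  \<comment> \<open>The error difference is an element of \<open>?G\<close> shorter than \<delta>,
    hence in \<open>lines ?G\<close>. It differs from the integer vector by an element of
    \<open>V\<close>, which also lies in \<open>lines ?G\<close>.\<close>
  have mem: "x (r m) - x (r M) \<in> layer 0 \<inter> lines ?G" if "m \<ge> M" for m
  proof -
    define c where "c = real (r M) - real (r m)"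
    have eq: "y (r m) - y (r M) = (x (r m) - x (r M)) + c *\<^sub>R v"
      by (simp add: y_def c_def algebra_simps)
    have cv: "c *\<^sub>R v \<in> V"
      using V v by (rule subspace_scale)
    have L: "x (r m) - x (r M) \<in> layer 0"
      using x by (intro layer_0_diff)
    then have "y (r m) - y (r M) \<in> lines ?G"
      using near0[OF _ M[OF that]] layer_0_plus_base cv unfolding eq by blast
    then have "(y (r m) - y (r M)) - c *\<^sub>R v \<in> lines ?G"
      using subspace_diff[OF sub _ V_lines[OF cv]] by blast
    with L show ?thesis
      by (simp add: eq)
  qed
  \<comment> \<open>Subtracting the fixed \<open>x (r M)\<close> and the bounded errors are both
    negligible after division by \<open>r m\<close>.\<close>
  have r_top: "filterlim (\<lambda>m. real (r m)) at_top sequentially"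
    using filterlim_compose[OF filterlim_real_sequentially filterlim_subseq[OF r]] .
  define q where "q m = (x (r m) - x (r M)) /\<^sub>R real (r m)" for m
  have "(\<lambda>m. q m - v) \<longlonglongrightarrow> 0"
  proof (rule Lim_null_comparison)
    define K where "K = 2 * real CARD('n) + norm (x (r M))"
    show "(\<lambda>m. K / real (r m)) \<longlonglongrightarrow> 0"
      using r_top by (intro tendsto_divide_0[OF tendsto_const] filterlim_at_top_imp_at_infinity)
    show "\<forall>\<^sub>F m in sequentially. norm (q m - v) \<le> K / real (r m)"
      using eventually_gt_at_top[of 0]
    proof eventually_elim
      case (elim m)
      then have pos: "real (r m) > 0"
        using seq_suble[OF r, of m] by simp
      then have "q m - v = (y (r m) - x (r M)) /\<^sub>R real (r m)"
        by (simp add: q_def y_def scaleR_diff_right)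
      moreover have "norm (y (r m) - x (r M)) \<le> K"
        using norm_triangle_ineq4[of "y (r m)" "x (r M)"] bound[of "r m"]
        by (simp add: y_def K_def)
      ultimately show ?case
        using pos by (simp add: divide_inverse_commute mult_left_mono)
    qed
  qed
  then have "q \<longlonglongrightarrow> v"
    by (simp add: LIM_zero_iff)
  moreover have "\<forall>\<^sub>F m in sequentially. q m \<in> span (layer 0 \<inter> lines ?G)"
    using eventually_ge_at_top[of M]
    unfolding q_def by eventually_elim (rule span_scale, rule span_base, rule mem)
  ultimately show "v \<in> span (layer 0 \<inter> lines ?G)"
    using Lim_in_closed_set[OF closed_span] by fastforce
qed

text \<open>
  The residual \<open>a\<close> of \<open>z\<close> modulo \<open>V\<close> stays shortest modulo \<open>layer_0_plus V\<close>, so it is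
  orthogonal to all lines therein. Hence the projection of \<open>z\<close> to \<open>V\<close> is also its projection to a rational
  subspace containing \<open>V\<close>, and so it is rational.
\<close>
lemma orthogonal_if_infdist_minimal:
  fixes V :: "(real ^ 'n::finite) set"
  assumes V: "subspace V" and V1: "\<And>v. v \<in> V \<Longrightarrow> inner v 1 = 0"
    and irr: "V \<inter> rat_vecs = {0}" and z: "z \<in> int_vecs"
    and min: "\<And>x. x \<in> layer 0 \<Longrightarrow> infdist z V \<le> infdist (z + x) V"
  shows "\<forall>v\<in>V. inner z v = 0"
proof -
  let ?G = "layer_0_plus V"
  obtain w a where "w \<in> span V" and a: "\<And>v. v \<in> span V \<Longrightarrow> orthogonal a v" and zwa: "z = w + a"
    using orthogonal_subspace_decomp_exists[of V z] by blast
  then have w: "w \<in> V"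
    using V by (metis span_eq_iff)
  have orth_a: "inner a v = 0" if "v \<in> V" for v
    using a[OF span_base[OF that]] by (simp add: orthogonal_def)
  \<comment> \<open>By Pythagoras, \<open>w\<close> is the point of \<open>V\<close> nearest to
    \<open>z\<close>.\<close>
  have "norm a \<le> infdist z V"
  proof -
    have "norm a \<le> dist z v" if "v \<in> V" for v
    proof -
      have "inner a (w - v) = 0"
        using orth_a w that by (simp add: inner_diff_right)
      then have "inner (z - v) (z - v) = inner a a + inner (w - v) (w - v)"
        using zwa by (simp add: algebra_simps inner_commute)
      then show ?thesis
        by (simp add: dist_norm norm_le)
    qed
    then show ?thesis
      using w by (subst infdist_notempty) (auto intro!: cINF_greatest)
  qed
  \<comment> \<open>Minimality of \<open>z\<close> gives this on the sums of \<open>layer 0\<close>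
    and \<open>V\<close>; being a closed condition, it extends to the closure.\<close>
  have short: "norm a \<le> norm (a + g)" if "g \<in> ?G" for g
  proof -
    have "norm a \<le> norm (a + s)" if s: "s \<in> {x + v | x v. x \<in> layer 0 \<and> v \<in> V}" for s
    proof -
      obtain x v where xv: "s = x + v" "x \<in> layer 0" "v \<in> V"
        using s by blast
      have "w - v \<in> V"
        using V w xv(3) by (rule subspace_diff)
      then have "infdist (z + x) V \<le> dist (z + x) (w - v)"
        by (rule infdist_le)
      also have "\<dots> = norm (a + s)"
        by (simp add: dist_norm zwa xv(1) algebra_simps)
      finally show ?thesis
        using \<open>norm a \<le> infdist z V\<close> min[OF xv(2)] by linarith
    qed
    moreover have "closed {s. norm a \<le> norm (a + s)}"
      by (intro closed_Collect_le continuous_intros)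
    ultimately have "?G \<subseteq> {s. norm a \<le> norm (a + s)}"
      unfolding layer_0_plus_def by (intro closure_minimal) auto
    with that show ?thesis
      by blast
  qed
  have orth_lines: "inner a u = 0" if "u \<in> lines ?G" for u
  proof (cases "u = 0")
    case False
    \<comment> \<open>This \<open>t\<close> minimises the quadratic function
      \<open>norm (a + t *\<^sub>R u)\<close> squared, whose minimum is below its value at 0 unless
      \<open>inner a u = 0\<close>.\<close>
    define t where "t = - inner a u / inner u u"
    have "norm a \<le> norm (a + t *\<^sub>R u)"
      using that by (intro short) (simp add: lines_def)
    then have "inner a a \<le> inner (a + t *\<^sub>R u) (a + t *\<^sub>R u)"
      by (simp add: norm_le)
    also have "\<dots> = inner a a + t * (2 * inner a u + t * inner u u)"
      by (simp add: inner_add_left inner_add_right inner_commute[of u a] algebra_simps)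
    also have "\<dots> = inner a a - (inner a u)\<^sup>2 / inner u u"
      using False by (simp add: t_def power2_eq_square)
    finally have "(inner a u)\<^sup>2 / inner u u \<le> 0"
      by simp
    with False show ?thesis
      by (smt (verit) inner_gt_zero_iff zero_less_divide_iff zero_less_power2)
  qed simp
  have "w \<in> rat_vecs"
  proof (rule rat_vecs_orthogonal_proj)
    show "layer 0 \<inter> lines ?G \<subseteq> rat_vecs"
      using int_vecs_subset_rat_vecs by (auto simp: layer_eq)
    show "z \<in> rat_vecs"
      using z int_vecs_subset_rat_vecs by blast
    show "w \<in> span (layer 0 \<inter> lines ?G)"
      using subspace_subset_span_layer_0[OF V V1] w by blast
    show "inner (z - w) x = 0" if "x \<in> layer 0 \<inter> lines ?G" for x
      using orth_lines that zwa by simp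
  qed
  with irr w have "w = 0"
    by blast
  with orth_a zwa show ?thesis
    by simp
qed

section \<open>Infinitely many core points\<close>

text \<open>As the distance to a closed set is attained, the tube is the Minkowski sum of
  \<open>V\<close> and a ball.\<close>

lemma convex_infdist_le:
  fixes V :: "'a::euclidean_space set"
  assumes "closed V" and "convex V" and "V \<noteq> {}"
  shows "convex {x. infdist x V \<le> c}"
proof -
  have "{x. infdist x V \<le> c} = (\<Union>v\<in>V. \<Union>y\<in>cball 0 c. {v + y})"
  proof (intro equalityI subsetI)
    fix x
    assume "x \<in> {x. infdist x V \<le> c}"
    moreover obtain v where "v \<in> V" "infdist x V = dist x v"
      using infdist_attains_inf[OF assms(1,3)] by blast
    ultimately have "v \<in> V" "x - v \<in> cball 0 c" "x = v + (x - v)"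
      by (simp_all add: dist_norm norm_minus_commute)
    then show "x \<in> (\<Union>v\<in>V. \<Union>y\<in>cball 0 c. {v + y})"
      by blast
  next
    fix x
    assume "x \<in> (\<Union>v\<in>V. \<Union>y\<in>cball 0 c. {v + y})"
    then show "x \<in> {x. infdist x V \<le> c}"
      by (auto simp: dist_norm intro!: infdist_le2)
  qed
  then show ?thesis
    using convex_sums[OF assms(2) convex_cball[of 0 c]] by simp
qed

text \<open>The elements of \<Gamma> are isometries mapping \<open>V\<close> into itself, so they
  preserve the tube around \<open>V\<close> through \<open>y\<close> and its slice by the
  layer.\<close>

lemma core_point_close_to_subspace:
  fixes \<Gamma> :: "('n::finite \<Rightarrow> 'n) set"
  assumes \<Gamma>: "subgroup \<Gamma> (BijGroup UNIV)" and inv: "invariant_subspace \<Gamma> V" and "y \<in> layer k"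
  obtains z where "z \<in> layer k" and "core_point \<Gamma> z" and "infdist z V \<le> infdist y V"
proof -
  define C where "C = {x. inner 1 x = of_int k} \<inter> {x. infdist x V \<le> infdist y V}"
  have V: "subspace V"
    using inv by (simp add: invariant_subspace_def)
  have "convex C"
    unfolding C_def using V subspace_0[OF V]
    by (intro convex_Int convex_hyperplane convex_infdist_le closed_subspace subspace_imp_convex) auto
  moreover have "perm_act g x \<in> C" if "g \<in> \<Gamma>" "x \<in> C" for g x
  proof -
    have "bij g"
      using \<Gamma> that(1) by (rule subgroup_BijGroup_bij)
    obtain v where "v \<in> V" "infdist x V = dist x v"
      using infdist_attains_inf[of V x] closed_subspace[OF V] subspace_0[OF V] by blast
    then have "infdist (perm_act g x) V \<le> infdist x V"
      using infdist_le[OF invariant_subspace_perm_act[OF inv that(1)], of v "perm_act g x"]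
      by (simp add: dist_perm_act[OF \<open>bij g\<close>])
    then show ?thesis
      using that(2) inner_one_perm_act[OF \<open>bij g\<close>, of x] by (simp add: C_def inner_commute)
  qed
  moreover have "y \<in> int_vecs \<inter> C"
    using assms(3) by (simp add: C_def layer_eq inner_commute)
  ultimately obtain z where "z \<in> int_vecs" "z \<in> C" "core_point \<Gamma> z"
    using core_point_in_convex_invariant_set[OF \<Gamma>, of C] by blast
  then show thesis
    by (intro that) (auto simp: C_def layer_eq inner_commute)
qed

lemma invariant_subspace_not_orthogonal_one:
  assumes \<Gamma>: "subgroup \<Gamma> (BijGroup UNIV)" and inv: "invariant_subspace \<Gamma> V"
    and "v \<in> V" and "inner v 1 \<noteq> 0"
  obtains p where "p \<in> V" and "p \<noteq> 0" and "\<And>g. g \<in> \<Gamma> \<Longrightarrow> perm_act g p = p"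
proof -
  have V: "subspace V"
    using inv by (simp add: invariant_subspace_def)
  obtain p q where "p \<in> span V" and q: "\<And>v. v \<in> span V \<Longrightarrow> orthogonal q v" and pq: "1 = p + q"
    using orthogonal_subspace_decomp_exists[of V 1] by blast
  then have p: "p \<in> V"
    using V by (metis span_eq_iff)
  have orth: "inner q u = 0" if "u \<in> V" for u
    using q[OF span_base[OF that]] by (simp add: orthogonal_def)
  have "p \<noteq> 0"
    using pq orth[OF assms(3)] assms(4) by (auto simp: inner_commute)
  moreover have "perm_act g p = p" if "g \<in> \<Gamma>" for g
  proof -
    let ?gp = "perm_act g p"
    have "bij g"
      using \<Gamma> that by (rule subgroup_BijGroup_bij)
    then have "dist 1 ?gp = dist 1 p"
      using dist_perm_act[of g 1 p] by (simp add: perm_act_one)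
    \<comment> \<open>\<open>?gp\<close> is a point of \<open>V\<close> as close to \<open>1\<close>
      as the projection \<open>p\<close>; by Pythagoras the nearest point is unique.\<close>
    then have "inner (q + (p - ?gp)) (q + (p - ?gp)) = inner q q"
      by (simp add: dist_norm norm_eq pq algebra_simps)
    moreover have "inner q (p - ?gp) = 0"
      using orth[OF p] orth[OF invariant_subspace_perm_act[OF inv that p]]
      by (simp add: inner_diff_right)
    ultimately have "inner (p - ?gp) (p - ?gp) = 0"
      by (simp only: inner_add_left inner_add_right inner_commute[of "p - ?gp" q])
    then show ?thesis
      by simp
  qed
  ultimately show thesis
    using p that by blast
qed

lemma layer_nonconstant:
  fixes z :: "real ^ 'n::finite"
  assumes "z \<in> layer k" and "\<not> int CARD('n) dvd k"
  shows "\<exists>j. z $ j \<noteq> z $ i"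
proof (rule ccontr)
  assume "\<not> ?thesis"
  then have "(\<Sum>j\<in>UNIV. z $ j) = (\<Sum>j::'n\<in>UNIV. z $ i)"
    by (intro sum.cong) auto
  then have "of_int k = real CARD('n) * z $ i"
    using assms(1) by (simp add: layer_def)
  moreover obtain m where "z $ i = of_int m"
    using assms(1) by (auto simp: layer_def int_vecs_def elim: Ints_cases)
  ultimately have "k = int CARD('n) * m"
    by (metis of_int_eq_iff of_int_mult of_int_of_nat_eq)
  with assms(2) show False
    by simp
qed

text \<open>Swapping coordinates \<open>i\<close> and \<open>j\<close> changes \<open>z\<close> by a
  multiple of the difference of two unit vectors, so orthogonality before and after forces
  \<open>v $ i = v $ j\<close> whenever \<open>z\<close> has different entries there.\<close>

lemma constant_if_orthogonal_transpositions:
  fixes z v :: "real ^ 'n::finite"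
  assumes "\<And>i. \<exists>j. z $ j \<noteq> z $ i"
    and "inner z v = 0" and "\<And>i j. inner (perm_act (Transposition.transpose i j) z) v = 0"
  shows "v $ i = v $ j"
proof -
  have neq: "v $ i = v $ j" if "z $ i \<noteq> z $ j" for i j
  proof -
    have "perm_act (Transposition.transpose i j) z =
        z + axis i (z $ j - z $ i) + axis j (z $ i - z $ j)"
      using that by (auto simp: perm_act_def vec_eq_iff axis_def Transposition.transpose_def)
    then have "(z $ j - z $ i) * (v $ i - v $ j) = 0"
      using assms(2) assms(3)[of i j] by (simp add: inner_add_left inner_axis' algebra_simps)
    with that show ?thesis
      by simp
  qed
  \<comment> \<open>Positions with equal entries of \<open>z\<close> are compared through a third
    position with a different entry.\<close>
  obtain l where "z $ l \<noteq> z $ i"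
    using assms(1) by blast
  with neq[of i l] neq[of l j] neq[of i j] show ?thesis
    by (cases "z $ i = z $ j") auto
qed

theorem theorem32:
  fixes \<Gamma> :: "('n::finite \<Rightarrow> 'n) set" and k :: int
  assumes "subgroup \<Gamma> (BijGroup (UNIV :: 'n set))"
    and "\<exists>V. irrational_invariant_subspace \<Gamma> V \<and> V \<noteq> {0}"
    and "\<not> int CARD('n) dvd k"
  shows "infinite {z \<in> layer k. core_point \<Gamma> z}"
proof -
  obtain V where inv: "invariant_subspace \<Gamma> V" and irr: "V \<inter> rat_vecs = {0}" and "V \<noteq> {0}"
    using assms(2) unfolding irrational_invariant_subspace_def by blast
  then have V: "subspace V"
    by (simp add: invariant_subspace_def)
  \<comment> \<open>A nonzero constant vector would put the rational all-ones vector into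
    \<open>V\<close>.\<close>
  have const: "v = 0" if "v \<in> V" "\<And>i j. v $ i = v $ j" for v
  proof (rule ccontr)
    assume "v \<noteq> 0"
    then obtain i where i: "v $ i \<noteq> 0"
      by (auto simp: vec_eq_iff)
    then have "1 = (1 / v $ i) *\<^sub>R v"
      using that(2) by (simp add: vec_eq_iff)
    then have "1 \<in> V"
      using subspace_scale[OF V that(1)] by metis
    moreover have "(1 :: real ^ 'n) \<in> rat_vecs"
      by (simp add: rat_vecs_def)
    ultimately have "(1 :: real ^ 'n) = 0"
      using irr by blast
    then show False
      by (simp add: vec_eq_iff)
  qed
  show ?thesis
  proof (cases "\<forall>v\<in>V. inner v 1 = 0")
    case False
    then obtain p where p: "p \<in> V" "p \<noteq> 0" "\<And>g. g \<in> \<Gamma> \<Longrightarrow> perm_act g p = p"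
      using invariant_subspace_not_orthogonal_one[OF assms(1) inv] by metis
    then obtain i j where "p $ i \<noteq> p $ j"
      using const by blast
    with p(3) show ?thesis
      by (intro infinite_core_points_if_fixed_vector[OF assms(1)])
  next
    case True
    show ?thesis
    proof
      let ?F = "{z \<in> layer k. core_point \<Gamma> z}"
      assume fin: "finite ?F"
      have "axis i (of_int k) \<in> layer k" for i :: 'n
        by (simp add: layer_eq int_vecs_axis inner_axis_one)
      then have "?F \<noteq> {}"
        using core_point_close_to_subspace[OF assms(1) inv] by blast
      then obtain z where z: "z \<in> layer k" and "\<And>y. y \<in> ?F \<Longrightarrow> infdist z V \<le> infdist y V"
        using ex_is_arg_min_if_finite[OF fin, of "\<lambda>y. infdist y V"]
        by (fastforce simp: is_arg_min_linorder)
      \<comment> \<open>Every layer point has a core point at most as far from \<open>V\<close>, so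
        the nearest of the finitely many core points is nearest in the whole layer.\<close>
      then have min: "infdist z V \<le> infdist y V" if "y \<in> layer k" for y
        using core_point_close_to_subspace[OF assms(1) inv that]
        by (metis (mono_tags, lifting) mem_Collect_eq order_trans)
      \<comment> \<open>Stated for every minimiser, since it is applied to \<open>z\<close> and to
        its transposed copies.\<close>
      have min_orth: "\<forall>v\<in>V. inner y v = 0"
        if "y \<in> layer k" "infdist y V \<le> infdist z V" for y
      proof (rule orthogonal_if_infdist_minimal)
        show "infdist y V \<le> infdist (y + x) V" if "x \<in> layer 0" for x
          using min[of "y + x"] \<open>y \<in> layer k\<close> \<open>infdist y V \<le> _\<close> that
          by (simp add: layer_eq int_vecs_add inner_add_left)
      qed (use V True irr that in \<open>auto simp: layer_eq\<close>)
      have z_orth: "\<forall>v\<in>V. inner z v = 0"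
        using min_orth z by blast
      have "norm z \<le> infdist z V"
      proof -
        have "norm z \<le> dist z v" if "v \<in> V" for v
        proof -
          have "inner (z - v) (z - v) = inner z z + inner v v"
            using z_orth that by (simp add: algebra_simps inner_commute)
          then show ?thesis
            by (simp add: dist_norm norm_le)
        qed
        then show ?thesis
          using subspace_0[OF V] by (subst infdist_notempty) (auto intro!: cINF_greatest)
      qed
      \<comment> \<open>Thus \<open>z\<close> has minimal norm in its layer, a property shared by all its coordinate
        permutations, including those outside of \<open>\<Gamma>\<close>.\<close>
      have "\<forall>v\<in>V. inner (perm_act (Transposition.transpose i j) z) v = 0" for i j
      proof (rule min_orth)
        let ?y = "perm_act (Transposition.transpose i j) z"
        show "?y \<in> layer k"
          using z by (simp add: layer_eq perm_act_int_vecs inner_one_perm_act)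
        have "infdist ?y V \<le> norm ?y"
          using infdist_le[OF subspace_0[OF V], of ?y] by simp
        then show "infdist ?y V \<le> infdist z V"
          using \<open>norm z \<le> infdist z V\<close> by (simp add: norm_perm_act)
      qed
      then have "v = 0" if "v \<in> V" for v
        using constant_if_orthogonal_transpositions[OF layer_nonconstant[OF z assms(3)]] z_orth that
        by (intro const) blast+
      then show False
        using \<open>V \<noteq> {0}\<close> subspace_0[OF V] by blast
    qed
  qed
qed

end
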